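(* As $x\to\infty$, $$\sum_{i,j\le x}(i,j)^{\ast}=G\,x^2\log x+O(x^2),$$ where $$G:=\zeta(2)^{-1}\prod_{q}\left(1-\frac1{(q+1)^2}\right),$$ the product being over all primes $q$.
   Context: A positive divisor $d$ of a positive integer $n$ is a unitary divisor of $n$ if $\gcd(d,n/d)=1$. For positive integers $i,j$, $(i,j)^{\ast}$ (the semi-unitary greatest common divisor) is the greatest divisor of $i$ which is a unitary divisor of $j$. The sum is over all ordered pairs of positive integers $i,j\le x$, and $\zeta$ is the Riemann zeta function. *)

theory Defs
  imports
    "HOL-Analysis.Analysis"
    "HOL-Computational_Algebra.Primes"
    "HOL-Library.Landau_Symbols"
begin

definition unitary_divisor :: "nat \<Rightarrow> nat \<Rightarrow> bool" where
  "unitary_divisor d n \<longleftrightarrow> 0 < d \<and> 0 < n \<and> d dvd n \<and> gcd d (n div d) = 1"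

(* Meaningful for positive i and j: then the set is finite and contains 1. *)
definition semi_unitary_gcd :: "nat \<Rightarrow> nat \<Rightarrow> nat" where
  "semi_unitary_gcd i j = Max {d. d dvd i \<and> unitary_divisor d j}"

(* The Riemann zeta function on the real half-line s > 1, by its Dirichlet series. *)
definition zeta :: "real \<Rightarrow> real" where
  "zeta s = (\<Sum>n. 1 / real (Suc n) powr s)"

(* The product over primes is the infinite product over all naturals in which
   the factors at non-primes are 1. *)
definition G_const :: real where
  "G_const = inverse (zeta 2) *
     (\<Prod>q::nat. if prime q then 1 - 1 / (real q + 1)\<^sup>2 else 1)"

end

theory Submission imports Defs begin

text \<open>Write $d \parallel j$ for "$d$ is a unitary divisor of $j$" and let $\varphi^*$ be the unitary
totient, given by $\varphi^*(p^k) = p^k - 1$ on prime powers and multiplicativity.  As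
$\sum_{d \parallel n} \varphi^*(d) = n$, and as the unitary divisors of $(i,j)^*$ are the $d \mid i$
with $d \parallel j$, the value $(i,j)^*$ is the sum of $\varphi^*(d)$ over these $d$
(\<open>semi_unitary_gcd_eq_sum\<close>).  Summing over $i$ and $j$ and writing $j = dk$ gives
\[ \sum_{i,j \le x} (i,j)^* = \sum_{d \le x} \varphi^*(d) \, \lfloor x/d \rfloor \, C(x/d, d), \]
where $C(y,d)$ counts the $k \le y$ coprime to $d$ (\<open>sum_semi_unitary_gcd\<close>).

Replace $C(y,d)$ by $y \varphi(d)/d$.  The usual error bound, the number of squarefree divisors of
$d$, loses a logarithm when it is summed over $d$.  Bounding each divisor's rounding error by
$\min(1, y/e) \le \sqrt{y/e}$ instead, the total over $d \le x$ with $y = x/d$ is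
$O(x \sum_e e^{-3/2}) = O(x)$ (\<open>coprime_count_error\<close>, \<open>sum_coprime_count_error\<close>).  Since
$\varphi^*(d) \lfloor x/d \rfloor \le x$, the double sum is
$x^2 \sum_{d \le x} h(d)/d + O(x^2)$ with $h(d) = \varphi(d) \varphi^*(d)/d^2$.

The function $h$ is close to $1$ at primes, so $h(n) = \sum_{d \mid n} g(d)$ with $g$ small:
$\sum_m |g(m)|/\sqrt m$ converges.  Therefore
\[ \sum_{n \le x} \frac{h(n)}{n} = \sum_{m \le x} \frac{g(m)}{m} \sum_{k \le x/m} \frac1k
   = \log x \, \sum_{m=1}^\infty \frac{g(m)}{m} + O(1), \]
the errors $O(1 + \log m)$ and the tail both being absorbed by the convergence of
$\sum |g(m)|/\sqrt m$ (\<open>sum_local_factor_ln\<close>).  The series $\sum g(m)/m$ has Euler factor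
$(1 - p^{-2})(1 - (p+1)^{-2})$ at $p$, and the product of these factors is $G$
(\<open>has_sum_factor_increment\<close>, \<open>tendsto_G_const\<close>).

All arithmetic functions involved are determined by their values at prime powers.  The identities
between them that are not pointwise follow by removing one prime power at a time (\<open>prime_power_peel_induct\<close>).\<close>

section \<open>Functions given by their values at prime powers\<close>

text \<open>The multiplicative function with prescribed values at prime powers.  With this encoding products,
quotients and absolute values are taken pointwise in \<open>F\<close>, and multiplicativity takes the one-prime
form \<open>mult_fun_prime_power_mult\<close>.\<close>
definition mult_fun :: "(nat \<Rightarrow> nat \<Rightarrow> real) \<Rightarrow> nat \<Rightarrow> real" where
  "mult_fun F n = (\<Prod>p\<in>prime_factors n. F p (multiplicity p n))"

lemma mult_fun_1 [simp]: "mult_fun F (Suc 0) = 1"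
  by (simp add: mult_fun_def)

lemma mult_fun_prime_power_mult:
  assumes p: "prime p" "\<not> p dvd n" and k: "k > 0"
  shows "mult_fun F (p ^ k * n) = F p k * mult_fun F n"
proof -
  have n: "n \<noteq> 0" using p by (metis dvd_0_right)
  have p0: "p \<noteq> 0" using p by auto
  have pf: "prime_factors (p ^ k * n) = insert p (prime_factors n)"
    using p k n p0 by (simp add: prime_factorization_mult prime_factorization_prime_power)
  have "p \<notin> prime_factors n" using p by auto
  moreover have "multiplicity p (p ^ k * n) = k"
    using p n p0 by (simp add: prime_elem_multiplicity_mult_distrib not_dvd_imp_multiplicity_0)
  moreover have "multiplicity q (p ^ k * n) = multiplicity q n" if "q \<in> prime_factors n" for q
  proof -
    from that have q: "prime q" "q dvd n" by auto
    hence "q \<noteq> p" using p by auto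
    thus ?thesis using p q n p0 
      by (simp add: prime_elem_multiplicity_mult_distrib multiplicity_distinct_prime_power)
  qed
  ultimately show ?thesis unfolding mult_fun_def pf by simp
qed

lemma prime_power_peel_induct [consumes 1, case_names one peel]:
  assumes "n > 0" "P (Suc 0)"
    and step: "\<And>p k n. \<lbrakk>prime p; k > 0; n > 0; \<not> p dvd n; P n\<rbrakk> \<Longrightarrow> P (p ^ k * n)"
  shows "P n"
  using \<open>n > 0\<close>
proof (induction n rule: less_induct)
  case (less n)
  show ?case
  proof (cases "n = 1")
    case True thus ?thesis using assms by simp
  next
    case False
    then obtain p where p: "prime p" "p dvd n" using prime_factor_nat by blast
    have "\<not> is_unit p" using p by auto
    then obtain m where m: "n = p ^ multiplicity p n * m" "\<not> p dvd m"
      using multiplicity_decompose'[of n p] less.prems by auto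
    have k: "multiplicity p n > 0" using p less.prems by (simp add: prime_multiplicity_gt_zero_iff)
    have m0: "m > 0" using m less.prems by (metis gr0I mult_0_right)
    have "p ^ multiplicity p n > 1" using one_less_power[OF prime_gt_1_nat[OF p(1)] k] .
    hence "m < n" using m m0 by (metis mult_less_cancel2 mult_1)
    from step[OF p(1) k m0 m(2) less.IH[OF this m0]] m(1) show ?thesis by simp
  qed
qed

lemma mult_fun_mult: "mult_fun F n * mult_fun H n = mult_fun (\<lambda>p k. F p k * H p k) n"
  by (simp add: mult_fun_def prod.distrib)

lemma mult_fun_divide: "mult_fun F n / mult_fun H n = mult_fun (\<lambda>p k. F p k / H p k) n"
  by (simp add: mult_fun_def prod_dividef)

lemma abs_mult_fun: "\<bar>mult_fun F n\<bar> = mult_fun (\<lambda>p k. \<bar>F p k\<bar>) n"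
  by (simp add: mult_fun_def abs_prod)

lemma mult_fun_cong:
  "(\<And>p k. prime p \<Longrightarrow> k > 0 \<Longrightarrow> F p k = H p k) \<Longrightarrow> mult_fun F n = mult_fun H n"
  unfolding mult_fun_def by (intro prod.cong) (auto simp: prime_factors_multiplicity)

lemma mult_fun_id: "n > 0 \<Longrightarrow> mult_fun (\<lambda>p k. real p ^ k) n = real n"
  by (induction n rule: prime_power_peel_induct) (simp_all add: mult_fun_prime_power_mult)

lemma divisors_prime_power_mult:
  assumes "prime (p::nat)" "\<not> p dvd n"
  shows "bij_betw (\<lambda>(a, d). p ^ a * d) ({..k} \<times> {d. d dvd n}) {d. d dvd p ^ k * n}"
  unfolding bij_betw_def
proof
  have n: "n \<noteq> 0" and p0: "p \<noteq> 0" using assms by (metis dvd_0_right, metis not_prime_0)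
  have mult: "multiplicity p (p ^ a * d) = a" if "d dvd n" for a d
  proof -
    have "\<not> p dvd d" "d \<noteq> 0" using that assms n by (auto dest: dvd_trans)
    thus ?thesis using assms p0
      by (simp add: prime_elem_multiplicity_mult_distrib not_dvd_imp_multiplicity_0)
  qed
  show "inj_on (\<lambda>(a, d). p ^ a * d) ({..k} \<times> {d. d dvd n})"
  proof (rule inj_onI, clarsimp)
    fix a d a' d' assume *: "d dvd n" "d' dvd n" "p ^ a * d = p ^ a' * d'"
    hence "a = a'" using mult[of d a] mult[of d' a'] by simp
    thus "a = a' \<and> d = d'" using * p0 by simp
  qed
  show "(\<lambda>(a, d). p ^ a * d) ` ({..k} \<times> {d. d dvd n}) = {d. d dvd p ^ k * n}"
  proof (intro equalityI subsetI)
    fix e assume "e \<in> {d. d dvd p ^ k * n}"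
    hence "e dvd p ^ k * n" by simp
    then obtain b d where bd: "e = b * d" "b dvd p ^ k" "d dvd n" by (rule division_decomp[THEN exE]) blast
    then obtain a where "a \<le> k" "b = p ^ a" using divides_primepow_nat assms by blast
    thus "e \<in> (\<lambda>(a, d). p ^ a * d) ` ({..k} \<times> {d. d dvd n})" using bd by auto
  qed (auto intro!: mult_dvd_mono le_imp_power_dvd)
qed

text \<open>Dirichlet convolution with $1$ sums the values at prime powers: in the sum over $\{0,\dots,k\} \times
\{d \mid n\}$ that parametrizes the divisors of $p^k n$, the two variables separate.\<close>
lemma sum_divisors_mult_fun:
  assumes "n > 0"
  shows "(\<Sum>d | d dvd n. mult_fun F d) = mult_fun (\<lambda>p k. 1 + (\<Sum>a=1..k. F p a)) n"
  using assms
proof (induction n rule: prime_power_peel_induct)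
  case one thus ?case by simp
next
  case (peel p k n)
  have "(\<Sum>d | d dvd p ^ k * n. mult_fun F d) = (\<Sum>(a, d)\<in>{..k} \<times> {d. d dvd n}. mult_fun F (p ^ a * d))"
    by (subst sum.reindex_bij_betw[OF divisors_prime_power_mult, symmetric]) (use peel in \<open>auto simp: case_prod_unfold\<close>)
  also have "\<dots> = (\<Sum>(a, d)\<in>{..k} \<times> {d. d dvd n}. (if a = 0 then 1 else F p a) * mult_fun F d)"
  proof (intro sum.cong refl, clarify)
    fix a d assume "d dvd n"
    hence "\<not> p dvd d" using peel dvd_trans by blast
    thus "mult_fun F (p ^ a * d) = (if a = 0 then 1 else F p a) * mult_fun F d"
      using peel mult_fun_prime_power_mult[of p d a F] by (cases "a = 0") auto
  qed
  also have "\<dots> = (\<Sum>a\<le>k. if a = 0 then 1 else F p a) * (\<Sum>d | d dvd n. mult_fun F d)"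
    by (simp add: sum_product sum.cartesian_product)
  also have "(\<Sum>a\<le>k. if a = 0 then 1 else F p a) = 1 + (\<Sum>a=1..k. F p a)"
    by (simp add: atMost_atLeast0 sum.atLeast_Suc_atMost)
  finally show ?case using peel by (simp add: mult_fun_prime_power_mult)
qed

section \<open>Euler products\<close>

definition smooth :: "nat \<Rightarrow> nat set" where
  "smooth N = {n. n > 0 \<and> (\<forall>p. prime p \<longrightarrow> p dvd n \<longrightarrow> p < N)}"

lemma smooth_0: "smooth 0 = {Suc 0}"
  by (auto simp: smooth_def) (metis One_nat_def prime_factor_nat)

lemma smooth_Suc_not_prime: "\<not> prime N \<Longrightarrow> smooth (Suc N) = smooth N"
  by (auto simp: smooth_def less_Suc_eq)

lemma bij_betw_smooth_Suc:
  assumes "prime N"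
  shows "bij_betw (\<lambda>(n, a). N ^ a * n) (smooth N \<times> UNIV) (smooth (Suc N))"
  unfolding bij_betw_def
proof
  have N0: "N \<noteq> 0" using assms by auto
  have ndvd: "\<not> N dvd n" if "n \<in> smooth N" for n
    using that assms by (auto simp: smooth_def)
  have mult: "multiplicity N (N ^ a * n) = a" if "n \<in> smooth N" for a n
    using ndvd[OF that] that assms N0
    by (auto simp: prime_elem_multiplicity_mult_distrib not_dvd_imp_multiplicity_0 smooth_def)
  show "inj_on (\<lambda>(n, a). N ^ a * n) (smooth N \<times> UNIV)"
  proof (rule inj_onI, clarsimp)
    fix n a n' a' assume *: "n \<in> smooth N" "n' \<in> smooth N" "N ^ a * n = N ^ a' * n'"
    hence "a = a'" using mult[of n a] mult[of n' a'] by simp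
    thus "n = n' \<and> a = a'" using * N0 by simp
  qed
  show "(\<lambda>(n, a). N ^ a * n) ` (smooth N \<times> UNIV) = smooth (Suc N)"
  proof (intro equalityI subsetI)
    fix m assume m: "m \<in> smooth (Suc N)"
    hence m0: "m \<noteq> 0" by (simp add: smooth_def)
    have "\<not> is_unit N" using assms by auto
    then obtain n where n: "m = N ^ multiplicity N m * n" "\<not> N dvd n"
      using multiplicity_decompose'[of m N] m0 by auto
    have "n \<in> smooth N"
      unfolding smooth_def
    proof (intro CollectI conjI allI impI)
      show "n > 0" using n m0 by (metis gr0I mult_0_right)
      fix p assume "prime p" "p dvd n"
      have "p dvd m" using \<open>p dvd n\<close> by (subst n(1)) (rule dvd_mult)
      hence "p < Suc N" using m \<open>prime p\<close> by (simp add: smooth_def)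
      thus "p < N" using n(2) \<open>p dvd n\<close> by (cases "p = N") auto
    qed
    thus "m \<in> (\<lambda>(n, a). N ^ a * n) ` (smooth N \<times> UNIV)" using n(1) by force
  next
    fix m assume "m \<in> (\<lambda>(n, a). N ^ a * n) ` (smooth N \<times> UNIV)"
    then obtain n a where na: "m = N ^ a * n" "n \<in> smooth N" by auto
    show "m \<in> smooth (Suc N)"
      unfolding smooth_def
    proof (intro CollectI conjI allI impI)
      show "m > 0" using na N0 by (simp add: smooth_def)
      fix p assume p: "prime p" "p dvd m"
      hence "p dvd N \<or> p dvd n" using na by (auto simp: prime_dvd_mult_iff dest: prime_dvd_power)
      thus "p < Suc N"
        using p(1) assms na(2) primes_dvd_imp_eq[of p N] by (auto simp: smooth_def less_Suc_eq)
    qed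
  qed
qed

lemma has_sum_product_real:
  fixes f :: "'a \<Rightarrow> real" and g :: "'b \<Rightarrow> real"
  assumes f: "(f has_sum s) A" and g: "(g has_sum t) B"
  shows "((\<lambda>(x, y). f x * g y) has_sum (s * t)) (A \<times> B)"
proof -
  have fa: "(\<lambda>x. \<bar>f x\<bar>) summable_on A"
    using f summable_on_iff_abs_summable_on_real has_sum_imp_summable by fastforce
  have ga: "(\<lambda>y. \<bar>g y\<bar>) summable_on B"
    using g summable_on_iff_abs_summable_on_real has_sum_imp_summable by fastforce
  have "(\<lambda>(x, y). \<bar>f x\<bar> * \<bar>g y\<bar>) summable_on (SIGMA x:A. B)"
    by (rule summable_on_SigmaI[where g = "\<lambda>x. \<bar>f x\<bar> * (\<Sum>\<^sub>\<infinity>y\<in>B. \<bar>g y\<bar>)"])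
       (auto intro!: has_sum_cmult_right summable_on_cmult_left fa has_sum_infsum ga)
  hence "(\<lambda>(x, y). f x * g y) summable_on (SIGMA x:A. B)"
    by (subst summable_on_iff_abs_summable_on_real) (simp add: case_prod_unfold abs_mult)
  thus ?thesis
    by (intro has_sum_SigmaI[where g = "\<lambda>x. f x * t"])
       (auto intro!: has_sum_cmult_right has_sum_cmult_left f g)
qed

text \<open>The partial Euler product over $p < N$ is the sum over the integers all of whose prime factors are
below $N$: passing from $N$ to $N+1$ with $N$ prime multiplies the index set by the powers of $N$.\<close>
lemma has_sum_mult_fun_smooth:
  assumes "\<And>p. prime p \<Longrightarrow> summable (\<lambda>a. \<bar>F p (Suc a)\<bar>)"
  shows "(mult_fun F has_sum (\<Prod>p<N. if prime p then 1 + (\<Sum>a. F p (Suc a)) else 1)) (smooth N)"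
proof (induction N)
  case 0
  show ?case by (simp add: smooth_0 has_sum_finite_iff)
next
  case (Suc N)
  show ?case
  proof (cases "prime N")
    case False
    thus ?thesis using Suc by (simp add: smooth_Suc_not_prime)
  next
    case True
    define G where "G = (\<lambda>a. if a = 0 then 1 else F N a)"
    have s: "summable (\<lambda>a. F N (Suc a))"
      using assms[OF True] by (rule summable_rabs_cancel)
    have "(\<lambda>a. G (Suc a)) sums (\<Sum>a. F N (Suc a))"
      using s by (simp add: G_def summable_sums)
    hence "G sums ((\<Sum>a. F N (Suc a)) + G 0)" by (rule sums_Suc)
    moreover have "summable (\<lambda>a. norm (G a))"
      using assms[OF True] by (subst summable_Suc_iff[symmetric]) (simp add: G_def)
    ultimately have "(G has_sum ((\<Sum>a. F N (Suc a)) + G 0)) UNIV"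
      by (intro norm_summable_imp_has_sum)
    from has_sum_product_real[OF Suc this]
    have "((\<lambda>(n, a). mult_fun F n * G a) has_sum
        (\<Prod>p<Suc N. if prime p then 1 + (\<Sum>a. F p (Suc a)) else 1)) (smooth N \<times> UNIV)"
      using True by (simp add: G_def add_ac)
    also have "?this \<longleftrightarrow> ((\<lambda>x. mult_fun F (case x of (n, a) \<Rightarrow> N ^ a * n)) has_sum
        (\<Prod>p<Suc N. if prime p then 1 + (\<Sum>a. F p (Suc a)) else 1)) (smooth N \<times> UNIV)"
    proof (intro has_sum_cong, clarify)
      fix n a assume "n \<in> smooth N"
      hence "\<not> N dvd n" using True by (auto simp: smooth_def)
      thus "mult_fun F n * G a = mult_fun F (N ^ a * n)"
        using mult_fun_prime_power_mult[OF True, of n a F] by (auto simp: G_def)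
    qed
    also have "\<dots> \<longleftrightarrow> ?thesis"
      by (rule has_sum_reindex_bij_betw[OF bij_betw_smooth_Suc[OF True]])
    finally show ?thesis .
  qed
qed

lemma finite_subset_smooth:
  assumes "finite X" "X \<subseteq> {0<..}"
  shows "eventually (\<lambda>N. X \<subseteq> smooth N) sequentially"
proof -
  \<comment> \<open>No prime factor of an element of \<open>X\<close> exceeds the maximum of \<open>X\<close>.\<close>
  have "X \<subseteq> smooth N" if "N \<ge> Suc (Max (insert 0 X))" for N
  proof
    fix n assume n: "n \<in> X"
    hence "n \<le> Max (insert 0 X)" using assms by simp
    hence "n < N" using that by simp
    thus "n \<in> smooth N" using n assms by (auto simp: smooth_def dest!: dvd_imp_le)
  qed
  thus ?thesis by (auto simp: eventually_sequentially)
qed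

text \<open>Applied to the absolute values, the partial products are at most $\exp(\sum_p t(p))$, which bounds
all finite sums of $|f|$ and gives absolute convergence.  Then the partial products tend to the full sum,
because the sets of smooth numbers exhaust the positive integers.\<close>
theorem euler_product:
  assumes summ: "\<And>p. prime p \<Longrightarrow> summable (\<lambda>a. \<bar>F p (Suc a)\<bar>)"
    and bound: "\<And>p. prime p \<Longrightarrow> (\<Sum>a. \<bar>F p (Suc a)\<bar>) \<le> t p"
    and t: "summable t" "\<And>p. t p \<ge> 0"
  shows "mult_fun F summable_on {0<..}"
    and "(\<lambda>N. \<Prod>p<N. if prime p then 1 + (\<Sum>a. F p (Suc a)) else 1)
           \<longlonglongrightarrow> (\<Sum>\<^sub>\<infinity>n\<in>{0<..}. mult_fun F n)"
proof -
  let ?A = "\<lambda>p k. \<bar>F p k\<bar>"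
  have nonneg: "mult_fun ?A n \<ge> 0" for n by (simp add: mult_fun_def prod_nonneg)
  have le: "sum (mult_fun ?A) X \<le> exp (suminf t)" if X: "finite X" "X \<subseteq> {0<..}" for X
  proof -
    from finite_subset_smooth[OF X] obtain N where N: "X \<subseteq> smooth N"
      by (auto simp: eventually_sequentially)
    have "sum (mult_fun ?A) X \<le> (\<Prod>p<N. if prime p then 1 + (\<Sum>a. ?A p (Suc a)) else 1)"
      by (rule finite_sum_le_has_sum[OF has_sum_mult_fun_smooth]) (use summ X N nonneg in auto)
    also have "\<dots> \<le> (\<Prod>p<N. exp (t p))"
    proof (intro prod_mono conjI)
      fix p
      show "0 \<le> (if prime p then 1 + (\<Sum>a. ?A p (Suc a)) else 1)"
        using suminf_nonneg[OF summ] by (auto intro: add_nonneg_nonneg)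
      show "(if prime p then 1 + (\<Sum>a. ?A p (Suc a)) else 1) \<le> exp (t p)"
      proof (cases "prime p")
        case True
        have "1 + (\<Sum>a. ?A p (Suc a)) \<le> 1 + t p" using bound[OF True] by simp
        also have "\<dots> \<le> exp (t p)" by (rule exp_ge_add_one_self)
        finally show ?thesis using True by simp
      qed (use t in simp)
    qed
    also have "\<dots> = exp (\<Sum>p<N. t p)" by (simp add: exp_sum)
    also have "\<dots> \<le> exp (suminf t)" using t by (simp add: sum_le_suminf)
    finally show ?thesis .
  qed
  have "mult_fun ?A summable_on {0<..}"
    by (rule nonneg_bdd_above_summable_on) (use nonneg le in \<open>auto intro!: bdd_aboveI\<close>)
  thus *: "mult_fun F summable_on {0<..}"
    by (subst summable_on_iff_abs_summable_on_real) (simp add: abs_mult_fun)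
  have P: "(\<Prod>p<N. if prime p then 1 + (\<Sum>a. F p (Suc a)) else 1) = (\<Sum>\<^sub>\<infinity>n\<in>smooth N. mult_fun F n)" for N
    by (rule infsumI[symmetric, OF has_sum_mult_fun_smooth[OF summ]])
  show "(\<lambda>N. \<Prod>p<N. if prime p then 1 + (\<Sum>a. F p (Suc a)) else 1)
           \<longlonglongrightarrow> (\<Sum>\<^sub>\<infinity>n\<in>{0<..}. mult_fun F n)"
    unfolding P
  proof (rule metric_LIMSEQ_I)
    fix e :: real assume e: "e > 0"
    let ?S = "\<Sum>\<^sub>\<infinity>n\<in>{0<..}. mult_fun F n"
    have "(sum (mult_fun F) \<longlongrightarrow> ?S) (finite_subsets_at_top {0<..})"
      using * has_sum_infsum has_sum_def by blast
    hence "eventually (\<lambda>X. dist (sum (mult_fun F) X) ?S < e/2) (finite_subsets_at_top {0<..})"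
      using e by (intro tendstoD) auto
    then obtain X where X: "finite X" "X \<subseteq> {0<..}"
      and XY: "\<And>Y. finite Y \<Longrightarrow> X \<subseteq> Y \<Longrightarrow> Y \<subseteq> {0<..} \<Longrightarrow> dist (sum (mult_fun F) Y) ?S < e/2"
      unfolding eventually_finite_subsets_at_top by (elim exE conjE, intro that) auto
    from finite_subset_smooth[OF X] obtain N0 where N0: "\<And>N. N \<ge> N0 \<Longrightarrow> X \<subseteq> smooth N"
      by (auto simp: eventually_sequentially)
    show "\<exists>N0. \<forall>N\<ge>N0. dist (\<Sum>\<^sub>\<infinity>n\<in>smooth N. mult_fun F n) ?S < e"
    proof (intro exI allI impI)
      fix N assume N: "N \<ge> N0"
      have sub: "smooth N \<subseteq> {0<..}" by (auto simp: smooth_def)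
      have "(sum (mult_fun F) \<longlongrightarrow> (\<Sum>\<^sub>\<infinity>n\<in>smooth N. mult_fun F n)) (finite_subsets_at_top (smooth N))"
        using has_sum_infsum[OF summable_on_subset_banach[OF * sub]] by (simp add: has_sum_def)
      moreover have "eventually (\<lambda>Y. dist (sum (mult_fun F) Y) ?S \<le> e/2) (finite_subsets_at_top (smooth N))"
        unfolding eventually_finite_subsets_at_top
        using X N0[OF N] XY sub by (intro exI[of _ X]) (auto intro: less_imp_le)
      ultimately have "dist (\<Sum>\<^sub>\<infinity>n\<in>smooth N. mult_fun F n) ?S \<le> e/2"
        by (intro tendsto_upperbound[OF tendsto_dist[OF _ tendsto_const]]) auto
      thus "dist (\<Sum>\<^sub>\<infinity>n\<in>smooth N. mult_fun F n) ?S < e" using e by simp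
    qed
  qed
qed

text \<open>Each of the three Euler products below is dominated, at every prime, by a geometric series of ratio
$1/2$; the sum over $p$ of the leading terms is what has to converge.\<close>
lemma euler_product_geometric:
  assumes le: "\<And>p a. prime p \<Longrightarrow> \<bar>F p (Suc a)\<bar> \<le> c p * (1/2) ^ a"
    and c: "summable c" "\<And>p. c p \<ge> 0"
  shows "mult_fun F summable_on {0<..}"
    and "(\<lambda>N. \<Prod>p<N. if prime p then 1 + (\<Sum>a. F p (Suc a)) else 1)
           \<longlonglongrightarrow> (\<Sum>\<^sub>\<infinity>n\<in>{0<..}. mult_fun F n)"
proof -
  have geo: "(\<lambda>a. c p * (1/2) ^ a) sums (2 * c p)" for p
    using sums_mult[OF geometric_sums[of "1/2::real"], of "c p"] by (simp add: mult.commute)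
  have summ: "summable (\<lambda>a. \<bar>F p (Suc a)\<bar>)" if "prime p" for p
    by (rule summable_comparison_test'[OF sums_summable[OF geo[of p]]]) (use le that in auto)
  have bound: "(\<Sum>a. \<bar>F p (Suc a)\<bar>) \<le> 2 * c p" if "prime p" for p
    using suminf_le[OF le[OF that] summ[OF that] sums_summable[OF geo]] sums_unique[OF geo[of p]] by simp
  have t: "summable (\<lambda>p. 2 * c p)" "\<And>p. 2 * c p \<ge> 0" using c by (auto intro: summable_mult)
  show "mult_fun F summable_on {0<..}"
    by (rule euler_product(1)[OF summ bound t])
  show "(\<lambda>N. \<Prod>p<N. if prime p then 1 + (\<Sum>a. F p (Suc a)) else 1)
           \<longlonglongrightarrow> (\<Sum>\<^sub>\<infinity>n\<in>{0<..}. mult_fun F n)"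
    by (rule euler_product(2)[OF summ bound t])
qed

section \<open>The double sum as a sum over divisors\<close>

lemma mem_atLeastAtMost_floor_iff: "k \<in> {Suc 0..nat \<lfloor>y\<rfloor>} \<longleftrightarrow> k > 0 \<and> real k \<le> y"
  by (cases "y \<ge> 0") (auto simp: le_nat_iff le_floor_iff)

lemma unitary_divisor_iff:
  "unitary_divisor d n \<longleftrightarrow> n > 0 \<and> (\<exists>c. n = d * c \<and> coprime d c)"
  by (auto simp: unitary_divisor_def coprime_iff_gcd_eq_1 elim!: dvdE)

text \<open>The prime $p$ divides exactly one of $d$ and its cofactor, and that one takes all of $p^k$.\<close>
lemma unitary_divisor_prime_power_mult:
  assumes p: "prime p" "\<not> p dvd n" and k: "k > 0" and n: "n > 0"
  shows "unitary_divisor d (p ^ k * n) \<longleftrightarrow>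
           unitary_divisor d n \<or> (\<exists>e. d = p ^ k * e \<and> unitary_divisor e n)"
proof
  have p0: "p > 0" using p prime_gt_0_nat by blast
  assume "unitary_divisor d (p ^ k * n)"
  then obtain c where c: "p ^ k * n = d * c" "coprime d c"
    by (auto simp: unitary_divisor_iff)
  show "unitary_divisor d n \<or> (\<exists>e. d = p ^ k * e \<and> unitary_divisor e n)"
  proof (cases "p dvd d")
    case True
    hence "\<not> p dvd c" using c(2) p(1) not_coprimeI not_prime_unit by blast
    hence "coprime (p ^ k) c" using p(1) by (simp add: prime_imp_coprime)
    hence "p ^ k dvd d" using c(1) by (metis coprime_dvd_mult_left_iff dvd_triv_left)
    then obtain e where e: "d = p ^ k * e" by (elim dvdE)
    hence "n = e * c" using c(1) p0 by (simp add: mult.assoc)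
    moreover have "coprime e c" using c(2) e by simp
    ultimately show ?thesis using e n by (auto simp: unitary_divisor_iff)
  next
    case False
    hence "coprime (p ^ k) d" using p(1) by (simp add: prime_imp_coprime)
    hence "p ^ k dvd c" using c(1) by (metis coprime_dvd_mult_right_iff dvd_triv_left)
    then obtain e where e: "c = p ^ k * e" by (elim dvdE)
    hence "n = d * e" using c(1) p0 by simp
    moreover have "coprime d e" using c(2) e by simp
    ultimately show ?thesis using n by (auto simp: unitary_divisor_iff)
  qed
next
  have p0: "p > 0" using p prime_gt_0_nat by blast
  have cop: "coprime (p ^ k) e" if "e dvd n" for e
    using p dvd_trans[OF _ that, of p] by (auto intro: prime_imp_coprime)
  assume "unitary_divisor d n \<or> (\<exists>e. d = p ^ k * e \<and> unitary_divisor e n)"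
  thus "unitary_divisor d (p ^ k * n)"
  proof
    assume "unitary_divisor d n"
    then obtain c where c: "n = d * c" "coprime d c" by (auto simp: unitary_divisor_iff)
    hence "coprime d (p ^ k * c)" using cop[of d] by (auto simp: coprime_commute)
    moreover have "p ^ k * n = d * (p ^ k * c)" using c by simp
    ultimately show ?thesis using n p0 unfolding unitary_divisor_iff by auto
  next
    assume "\<exists>e. d = p ^ k * e \<and> unitary_divisor e n"
    then obtain e c where c: "d = p ^ k * e" "n = e * c" "coprime e c"
      by (auto simp: unitary_divisor_iff)
    hence "coprime d c" using cop[of c] by auto
    moreover have "p ^ k * n = d * c" "p ^ k * n > 0" using c n p0 by simp_all
    ultimately show ?thesis unfolding unitary_divisor_iff by blast
  qed
qed

definition unitary_totient :: "nat \<Rightarrow> real" where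
  "unitary_totient = mult_fun (\<lambda>p k. real p ^ k - 1)"

text \<open>Let $D(i,j)$ be the set of $d \mid i$ with $d \parallel j$, and pass from $n$ to $p^k n$ with $p \nmid n$.
If $p^k \nmid i$ then $D$ does not change.  Otherwise $D$ gains the disjoint copy $p^k D$; the maximum
is multiplied by $p^k$, and the sum of $\varphi^*$ by $1 + (p^k - 1)$.\<close>
lemma semi_unitary_gcd_eq_sum:
  assumes "j > 0"
  shows "real (semi_unitary_gcd i j) = (\<Sum>d | d dvd i \<and> unitary_divisor d j. unitary_totient d)"
proof -
  define D where "D = (\<lambda>j. {d. d dvd i \<and> unitary_divisor d j})"
  have fin: "finite (D j)" if "j > 0" for j
    by (rule finite_subset[of _ "{d. d dvd j}"]) (use that in \<open>auto simp: D_def unitary_divisor_def\<close>)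
  have one: "Suc 0 \<in> D j" if "j > 0" for j
    using that by (simp add: D_def unitary_divisor_def)
  have "real (Max (D j)) = (\<Sum>d\<in>D j. unitary_totient d)"
    using assms
  proof (induction j rule: prime_power_peel_induct)
    case one
    have "D (Suc 0) = {Suc 0}" by (auto simp: D_def unitary_divisor_def)
    thus ?case by (simp add: unitary_totient_def)
  next
    case (peel p k n)
    have p0: "p > 0" using peel prime_gt_0_nat by blast
    have ndvd: "\<not> p dvd d" if "d \<in> D n" for d
      using that peel dvd_trans by (auto simp: D_def unitary_divisor_def)
    have split: "p ^ k * e dvd i \<longleftrightarrow> p ^ k dvd i \<and> e dvd i" if "unitary_divisor e n" for e
    proof -
      have "\<not> p dvd e" using that peel dvd_trans by (auto simp: unitary_divisor_def)
      hence "coprime (p ^ k) e" using peel by (simp add: prime_imp_coprime)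
      thus ?thesis by (meson divides_mult dvd_mult_left dvd_mult_right)
    qed
    show ?case
    proof (cases "p ^ k dvd i")
      case False
      hence "D (p ^ k * n) = D n"
        using split by (auto simp: D_def unitary_divisor_prime_power_mult peel)
      thus ?thesis using peel by simp
    next
      case True
      hence D: "D (p ^ k * n) = D n \<union> (\<lambda>d. p ^ k * d) ` D n"
        using split by (auto simp: D_def unitary_divisor_prime_power_mult peel)
      have M: "Max (D n) \<in> D n" using one[of n] fin[of n] peel by (intro Max_in) auto
      have le: "d \<le> Max (D n)" if "d \<in> D n" for d using that fin[of n] peel by simp
      have pk: "p ^ k \<ge> 1" using p0 by simp
      have "Max (D (p ^ k * n)) = p ^ k * Max (D n)"
      proof (rule Max_eqI)
        show "finite (D (p ^ k * n))" using fin p0 peel by simp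
        show "p ^ k * Max (D n) \<in> D (p ^ k * n)" using D M by auto
        fix d assume "d \<in> D (p ^ k * n)"
        thus "d \<le> p ^ k * Max (D n)"
          using D le mult_le_mono[OF pk] by auto
      qed
      moreover have "(\<Sum>d\<in>D (p ^ k * n). unitary_totient d) =
          (\<Sum>d\<in>D n. unitary_totient d) + (\<Sum>d\<in>(\<lambda>d. p ^ k * d) ` D n. unitary_totient d)"
        unfolding D
      proof (rule sum.union_disjoint)
        show "D n \<inter> (\<lambda>d. p ^ k * d) ` D n = {}"
        proof -
          have "p dvd p ^ k * d" for d using peel(2) by simp
          thus ?thesis using ndvd by blast
        qed
      qed (use fin peel in auto)
      moreover have "(\<Sum>d\<in>(\<lambda>d. p ^ k * d) ` D n. unitary_totient d) =
          (\<Sum>d\<in>D n. (real p ^ k - 1) * unitary_totient d)"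
        using p0 peel ndvd
        by (subst sum.reindex) (auto simp: inj_on_def unitary_totient_def mult_fun_prime_power_mult)
      moreover have "\<dots> = (real p ^ k - 1) * (\<Sum>d\<in>D n. unitary_totient d)"
        by (simp add: sum_distrib_left)
      ultimately show ?thesis using peel by (simp add: algebra_simps)
    qed
  qed
  thus ?thesis by (simp add: semi_unitary_gcd_def D_def)
qed

text \<open>Both sides run over the pairs $(d,k)$ with $dk \le x$.\<close>
lemma sum_divisors_swap:
  fixes f :: "nat \<Rightarrow> nat \<Rightarrow> real"
  shows "(\<Sum>n\<in>{1..nat \<lfloor>x\<rfloor>}. \<Sum>d | d dvd n. f d n) =
         (\<Sum>d\<in>{1..nat \<lfloor>x\<rfloor>}. \<Sum>k\<in>{1..nat \<lfloor>x / real d\<rfloor>}. f d (d * k))"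
proof -
  have "(\<Sum>n\<in>{1..nat \<lfloor>x\<rfloor>}. \<Sum>d | d dvd n. f d n) =
        (\<Sum>(n, d)\<in>(SIGMA n:{1..nat \<lfloor>x\<rfloor>}. {d. d dvd n}). f d n)"
    by (rule sum.Sigma) auto
  also have "\<dots> = (\<Sum>(d, k)\<in>(SIGMA d:{1..nat \<lfloor>x\<rfloor>}. {1..nat \<lfloor>x / real d\<rfloor>}). f d (d * k))"
  proof (rule sum.reindex_bij_witness[where i = "\<lambda>(d, k). (d * k, d)" and j = "\<lambda>(n, d). (d, n div d)"], goal_cases)
    case (1 a)
    thus ?case by auto
  next
    case (2 a)
    then obtain n d where a: "a = (n, d)" "n \<in> {1..nat \<lfloor>x\<rfloor>}" "d dvd n" by auto
    then obtain k where k: "n = d * k" by (elim dvdE)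
    have n: "n > 0" "real n \<le> x" using a(2) by (simp_all only: One_nat_def mem_atLeastAtMost_floor_iff)
    hence dk: "d > 0" "k > 0" using k by auto
    have "d \<le> n" using a(3) n by (simp add: dvd_imp_le)
    hence "real d \<le> x" using n by simp
    moreover have "real k \<le> x / real d" using n k dk by (simp add: field_simps)
    ultimately show ?case using a dk k by (simp add: mem_atLeastAtMost_floor_iff del: atLeastAtMost_iff)
  next
    case (3 b)
    thus ?case by auto
  next
    case (4 b)
    then obtain d k where b: "b = (d, k)" "d \<in> {1..nat \<lfloor>x\<rfloor>}" "k \<in> {1..nat \<lfloor>x / real d\<rfloor>}" by auto
    hence "d > 0" "k > 0" "real k \<le> x / real d" by (simp_all only: One_nat_def mem_atLeastAtMost_floor_iff)
    thus ?case using b by (simp add: mem_atLeastAtMost_floor_iff field_simps del: atLeastAtMost_iff)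
  next
    case (5 a)
    thus ?case by auto
  qed
  also have "\<dots> = (\<Sum>d\<in>{1..nat \<lfloor>x\<rfloor>}. \<Sum>k\<in>{1..nat \<lfloor>x / real d\<rfloor>}. f d (d * k))"
    by (rule sum.Sigma[symmetric]) auto
  finally show ?thesis .
qed

definition coprime_count :: "real \<Rightarrow> nat \<Rightarrow> nat" where
  "coprime_count y d = card {k \<in> {1..nat \<lfloor>y\<rfloor>}. coprime k d}"

text \<open>The multiples of $d$ up to $x$ are the $dk$ with $k \le x/d$.  The predicate on the cofactor \<open>k\<close>
lets the same bijection count plain multiples, multiples with coprime cofactor, and multiples of a
prime within a set of integers coprime to a modulus.\<close>
lemma card_multiples:
  assumes "d > 0"
  shows "card {i \<in> {1..nat \<lfloor>x\<rfloor>}. d dvd i \<and> P (i div d)} = card {k \<in> {1..nat \<lfloor>x / real d\<rfloor>}. P k}"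
proof (rule bij_betw_same_card[of "\<lambda>i. i div d"], rule bij_betw_byWitness[where f' = "\<lambda>k. d * k"])
  show "(\<lambda>i. i div d) ` {i \<in> {1..nat \<lfloor>x\<rfloor>}. d dvd i \<and> P (i div d)}
          \<subseteq> {k \<in> {1..nat \<lfloor>x / real d\<rfloor>}. P k}"
    using assms by (auto simp: mem_atLeastAtMost_floor_iff field_simps simp del: atLeastAtMost_iff elim!: dvdE)
  show "(\<lambda>k. d * k) ` {k \<in> {1..nat \<lfloor>x / real d\<rfloor>}. P k}
          \<subseteq> {i \<in> {1..nat \<lfloor>x\<rfloor>}. d dvd i \<and> P (i div d)}"
    using assms by (auto simp: mem_atLeastAtMost_floor_iff field_simps simp del: atLeastAtMost_iff)
qed (use assms in auto)

lemma sum_semi_unitary_gcd: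
  fixes x :: real
  defines "N \<equiv> nat \<lfloor>x\<rfloor>"
  shows "(\<Sum>(i, j)\<in>{1..N} \<times> {1..N}. real (semi_unitary_gcd i j)) =
         (\<Sum>d\<in>{1..N}. unitary_totient d * real (nat \<lfloor>x / real d\<rfloor>) * real (coprime_count (x / real d) d))"
proof -
  have "(\<Sum>(i, j)\<in>{1..N} \<times> {1..N}. real (semi_unitary_gcd i j)) =
        (\<Sum>(i, j)\<in>{1..N} \<times> {1..N}. \<Sum>d\<in>{1..N}.
           if d dvd i \<and> unitary_divisor d j then unitary_totient d else 0)"
  proof (intro sum.cong refl, clarify)
    fix i j assume ij: "i \<in> {1..N}" "j \<in> {1..N}"
    have "real (semi_unitary_gcd i j) = (\<Sum>d | d dvd i \<and> unitary_divisor d j. unitary_totient d)"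
      using ij by (intro semi_unitary_gcd_eq_sum) auto
    also have "{d. d dvd i \<and> unitary_divisor d j} = {d\<in>{1..N}. d dvd i \<and> unitary_divisor d j}"
      using ij by (auto simp: unitary_divisor_def dest: dvd_imp_le)
    also have "(\<Sum>d\<in>\<dots>. unitary_totient d) =
        (\<Sum>d\<in>{1..N}. if d dvd i \<and> unitary_divisor d j then unitary_totient d else 0)"
      by (intro sum.inter_filter) auto
    finally show "real (semi_unitary_gcd i j) = \<dots>" .
  qed
  also have "\<dots> = (\<Sum>d\<in>{1..N}. \<Sum>(i, j)\<in>{1..N} \<times> {1..N}.
           if d dvd i \<and> unitary_divisor d j then unitary_totient d else 0)"
    unfolding case_prod_unfold by (rule sum.swap)
  also have "\<dots> = (\<Sum>d\<in>{1..N}. unitary_totient d * real (nat \<lfloor>x / real d\<rfloor>) * real (coprime_count (x / real d) d))"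
  proof (intro sum.cong refl)
    fix d assume d: "d \<in> {1..N}"
    hence d0: "d > 0" by simp
    have "(\<Sum>(i, j)\<in>{1..N} \<times> {1..N}. if d dvd i \<and> unitary_divisor d j then unitary_totient d else 0) =
        (\<Sum>(i, j)\<in>{i\<in>{1..N}. d dvd i} \<times> {j\<in>{1..N}. unitary_divisor d j}. unitary_totient d)"
      by (rule sum.mono_neutral_cong_right) (auto split: if_splits)
    also have "\<dots> = unitary_totient d * (real (card {i\<in>{1..N}. d dvd i}) * real (card {j\<in>{1..N}. unitary_divisor d j}))"
      by (simp add: case_prod_unfold card_cartesian_product)
    also have "card {i\<in>{1..N}. d dvd i} = nat \<lfloor>x / real d\<rfloor>"
      using card_multiples[of d x "\<lambda>_. True"] d0 by (simp add: N_def Collect_mem_eq del: atLeastAtMost_iff)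
    also have "{j\<in>{1..N}. unitary_divisor d j} = {j\<in>{1..N}. d dvd j \<and> coprime (j div d) d}"
      using d by (auto simp: unitary_divisor_def coprime_iff_gcd_eq_1 gcd.commute)
    also have "card \<dots> = coprime_count (x / real d) d"
      using card_multiples[of d x "\<lambda>k. coprime k d"] d by (simp add: N_def coprime_count_def)
    finally show "(\<Sum>(i, j)\<in>{1..N} \<times> {1..N}. if d dvd i \<and> unitary_divisor d j then unitary_totient d else 0)
        = unitary_totient d * real (nat \<lfloor>x / real d\<rfloor>) * real (coprime_count (x / real d) d)"
      by simp
  qed
  finally show ?thesis .
qed

section \<open>Counting coprime integers\<close>

text \<open>Legendre's sieve step: the integers coprime to $d$ split into those coprime to $p$ and the multiples
of $p$.\<close>
lemma coprime_count_prime_power_mult: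
  assumes p: "prime p" "\<not> p dvd d" and k: "k > 0"
  shows "coprime_count y d = coprime_count y (p ^ k * d) + coprime_count (y / real p) d"
proof -
  have p0: "p > 0" using p prime_gt_0_nat by blast
  have cop: "coprime p d" using p by (simp add: prime_imp_coprime)
  have not_dvd: "coprime m (p ^ k) \<longleftrightarrow> \<not> p dvd m" for m
    using p k prime_imp_coprime[of p m] not_coprimeI[of p m p] not_prime_unit
    by (auto simp: coprime_commute)
  have dvd: "coprime m d \<longleftrightarrow> coprime (m div p) d" if "p dvd m" for m
    using that cop p0 by (auto elim!: dvdE)
  have "{m \<in> {1..nat \<lfloor>y\<rfloor>}. coprime m d} = 
      {m \<in> {1..nat \<lfloor>y\<rfloor>}. coprime m (p ^ k * d)} \<union>
      {m \<in> {1..nat \<lfloor>y\<rfloor>}. p dvd m \<and> coprime (m div p) d}"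
    using dvd by (auto simp: not_dvd simp del: coprime_power_right_iff)
  moreover have "{m \<in> {1..nat \<lfloor>y\<rfloor>}. coprime m (p ^ k * d)} \<inter>
      {m \<in> {1..nat \<lfloor>y\<rfloor>}. p dvd m \<and> coprime (m div p) d} = {}"
    by (auto simp: not_dvd simp del: coprime_power_right_iff)
  ultimately have "coprime_count y d = coprime_count y (p ^ k * d)
      + card {m \<in> {1..nat \<lfloor>y\<rfloor>}. p dvd m \<and> coprime (m div p) d}"
    unfolding coprime_count_def by (simp add: card_Un_disjoint)
  thus ?thesis
    unfolding coprime_count_def[of "y / real p"] by (simp only: card_multiples[OF p0, of y "\<lambda>m. coprime m d"])
qed

text \<open>By the sieve step, the error for $p^k d$ at $y$ is the error for $d$ at $y$ minus the error for $d$
at $y/p$.  The two bounds run over the disjoint sets of divisors $e$ and $pe$ of $p^k d$.  For $d = 1$ the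
error is at most $\min(1, y) \le \sqrt y$; the decay in $y$ is what makes the sum over $d$
small in \<open>sum_coprime_count_error\<close>.\<close>
lemma coprime_count_error:
  assumes "d > 0" "y \<ge> 0"
  shows "\<bar>real (coprime_count y d) - y * mult_fun (\<lambda>p k. 1 - 1 / real p) d\<bar>
           \<le> (\<Sum>e | e dvd d. sqrt (y / real e))"
  using assms
proof (induction d arbitrary: y rule: prime_power_peel_induct)
  case one
  have "real (nat \<lfloor>y\<rfloor>) = of_int \<lfloor>y\<rfloor>" using one by simp
  hence "\<bar>real (nat \<lfloor>y\<rfloor>) - y\<bar> \<le> y" "\<bar>real (nat \<lfloor>y\<rfloor>) - y\<bar> \<le> 1"
    using one by linarith+
  \<comment> \<open>The geometric mean of the bounds $y$ and $1$.\<close>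
  hence "\<bar>real (nat \<lfloor>y\<rfloor>) - y\<bar> * \<bar>real (nat \<lfloor>y\<rfloor>) - y\<bar> \<le> y * 1"
    using one by (intro mult_mono) auto
  hence "\<bar>real (nat \<lfloor>y\<rfloor>) - y\<bar> \<le> sqrt y"
    by (intro real_le_rsqrt) (simp add: power2_eq_square)
  thus ?case by (simp add: coprime_count_def Collect_mem_eq del: atLeastAtMost_iff)
next
  case (peel p k d)
  let ?F = "\<lambda>p k. 1 - 1 / real p"
  let ?E = "\<lambda>y d. real (coprime_count y d) - y * mult_fun ?F d"
  have p0: "p > 0" using peel prime_gt_0_nat by blast
  have count: "real (coprime_count y (p ^ k * d)) = real (coprime_count y d) - real (coprime_count (y / real p) d)"
    using coprime_count_prime_power_mult[of p d k y] peel by simp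
  have "?E y (p ^ k * d) = ?E y d - ?E (y / real p) d"
    unfolding count mult_fun_prime_power_mult[OF peel(1,4,2)] by (simp add: algebra_simps)
  hence "\<bar>?E y (p ^ k * d)\<bar> \<le> \<bar>?E y d\<bar> + \<bar>?E (y / real p) d\<bar>" by linarith
  also have "\<dots> \<le> (\<Sum>e | e dvd d. sqrt (y / real e)) + (\<Sum>e | e dvd d. sqrt (y / real p / real e))"
    using peel by (intro add_mono peel.IH) auto
  also have "(\<Sum>e | e dvd d. sqrt (y / real p / real e)) = (\<Sum>e\<in>(\<lambda>e. p * e) ` {e. e dvd d}. sqrt (y / real e))"
    using p0 by (subst sum.reindex) (auto simp: inj_on_def field_simps)
  also have "(\<Sum>e | e dvd d. sqrt (y / real e)) + \<dots> = (\<Sum>e\<in>{e. e dvd d} \<union> (\<lambda>e. p * e) ` {e. e dvd d}. sqrt (y / real e))"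
  proof (rule sum.union_disjoint[symmetric])
    show "{e. e dvd d} \<inter> (\<lambda>e. p * e) ` {e. e dvd d} = {}"
      using peel(4) by (auto dest: dvd_mult_left)
  qed (use peel in auto)
  also have "\<dots> \<le> (\<Sum>e | e dvd p ^ k * d. sqrt (y / real e))"
  proof (rule sum_mono2)
    have "p dvd p ^ k" using peel by simp
    thus "{e. e dvd d} \<union> (\<lambda>e. p * e) ` {e. e dvd d} \<subseteq> {e. e dvd p ^ k * d}"
      by (auto intro: mult_dvd_mono)
  qed (use peel p0 in auto)
  finally show ?case .
qed

lemma sum_inverse_sqrt_le: "(\<Sum>k\<in>{1..n}. 1 / sqrt (real k)) \<le> 2 * sqrt (real n)"
proof (induction n)
  case (Suc n)
  define a b where "a = sqrt (real n)" and "b = sqrt (real (Suc n))"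
  have ab: "a \<ge> 0" "b > 0" "a \<le> b" "b\<^sup>2 - a\<^sup>2 = 1" by (auto simp: a_def b_def)
  \<comment> \<open>Telescoping: the new term is at most the increment of the right-hand side.\<close>
  have "1 = (b - a) * (b + a)" using ab by (simp add: algebra_simps power2_eq_square)
  also have "\<dots> \<le> (b - a) * (2 * b)" using ab by (intro mult_left_mono) auto
  finally have "1 / b \<le> 2 * (b - a)" using ab by (simp add: field_simps)
  thus ?case using Suc by (simp add: a_def b_def)
qed simp

text \<open>The term at $n = 0$ vanishes, as \<open>0 powr a = 0\<close>; so this is $\zeta(3/2)$.\<close>
definition zeta_three_halves :: real where
  "zeta_three_halves = (\<Sum>n. real n powr (-3/2))"

lemma summable_powr_three_halves: "summable (\<lambda>n. real n powr (-3/2))"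
  by (simp add: summable_real_powr_iff)

lemma powr_minus_three_halves:
  assumes "n > 0"
  shows "real n powr (-3/2) = 1 / (real n * sqrt (real n))"
proof -
  have "real n powr (3/2) = real n powr (1 + 1/2)" by simp
  also have "\<dots> = real n * sqrt (real n)" using assms by (subst powr_add) (simp add: powr_half_sqrt)
  finally show ?thesis by (simp add: powr_minus_divide)
qed

text \<open>With $d = ek$ the bounds $\sqrt{x/(de)} = \sqrt{x/k}/e$ sum over $k \le x/e$ to at most
$2x e^{-3/2}$, and this converges over $e$.\<close>
lemma sum_coprime_count_error:
  assumes "x \<ge> 1"
  shows "(\<Sum>d\<in>{1..nat \<lfloor>x\<rfloor>}. \<bar>real (coprime_count (x / real d) d) - x / real d * mult_fun (\<lambda>p k. 1 - 1 / real p) d\<bar>)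
           \<le> 2 * zeta_three_halves * x" (is "?lhs \<le> _")
proof -
  have "?lhs \<le> (\<Sum>d\<in>{1..nat \<lfloor>x\<rfloor>}. \<Sum>e | e dvd d. sqrt (x / real d / real e))"
    using assms by (intro sum_mono coprime_count_error) auto
  also have "\<dots> = (\<Sum>e\<in>{1..nat \<lfloor>x\<rfloor>}. \<Sum>k\<in>{1..nat \<lfloor>x / real e\<rfloor>}. sqrt (x / real (e * k) / real e))"
    by (rule sum_divisors_swap)
  also have "\<dots> \<le> (\<Sum>e\<in>{1..nat \<lfloor>x\<rfloor>}. 2 * x * real e powr (-3/2))"
  proof (intro sum_mono)
    fix e assume "e \<in> {1..nat \<lfloor>x\<rfloor>}"
    hence e: "e > 0" by simp
    have "(\<Sum>k\<in>{1..nat \<lfloor>x / real e\<rfloor>}. sqrt (x / real (e * k) / real e)) =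
        sqrt x / real e * (\<Sum>k\<in>{1..nat \<lfloor>x / real e\<rfloor>}. 1 / sqrt (real k))"
      unfolding sum_distrib_left using e assms
      by (intro sum.cong) (auto simp: real_sqrt_divide real_sqrt_mult field_simps)
    also have "\<dots> \<le> sqrt x / real e * (2 * sqrt (real (nat \<lfloor>x / real e\<rfloor>)))"
      using e assms by (intro mult_left_mono sum_inverse_sqrt_le) auto
    also have "\<dots> \<le> sqrt x / real e * (2 * sqrt (x / real e))"
      using e assms by (intro mult_left_mono real_sqrt_le_mono) auto
    also have "\<dots> = 2 * x * (1 / (real e * sqrt (real e)))"
      using assms by (simp add: real_sqrt_divide)
    also have "\<dots> = 2 * x * real e powr (-3/2)"
      using e by (simp only: powr_minus_three_halves)
    finally show "(\<Sum>k\<in>{1..nat \<lfloor>x / real e\<rfloor>}. sqrt (x / real (e * k) / real e)) \<le> 2 * x * real e powr (-3/2)" .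
  qed
  also have "\<dots> = 2 * x * (\<Sum>e\<in>{1..nat \<lfloor>x\<rfloor>}. real e powr (-3/2))"
    by (simp add: sum_distrib_left)
  also have "\<dots> \<le> 2 * x * zeta_three_halves"
    unfolding zeta_three_halves_def using assms
    by (intro mult_left_mono sum_le_suminf summable_powr_three_halves) auto
  finally show ?thesis by (simp add: mult_ac)
qed

text \<open>The value of $\varphi(n) \varphi^*(n)/n^2$ at $n = p^k$, $k \ge 1$; so \<open>mult_fun local_factor\<close> is
the function $h$ of the opening text.\<close>
definition local_factor :: "nat \<Rightarrow> nat \<Rightarrow> real" where
  "local_factor p k = (1 - 1 / real p) * (1 - 1 / real p ^ k)"

lemma prime_factor_ge_1: "p \<in> prime_factors d \<Longrightarrow> real p \<ge> 1"
  using prime_ge_1_nat[of p] by auto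

lemma unitary_totient_nonneg: "unitary_totient d \<ge> 0"
  unfolding unitary_totient_def mult_fun_def
  using prime_factor_ge_1 by (auto intro!: prod_nonneg one_le_power)

lemma unitary_totient_le: "d > 0 \<Longrightarrow> unitary_totient d \<le> real d"
  unfolding mult_fun_id[of d, symmetric] unfolding unitary_totient_def mult_fun_def
  using prime_factor_ge_1 by (intro prod_mono) (auto intro!: one_le_power)

lemma unitary_totient_mult:
  assumes "d > 0"
  shows "unitary_totient d * mult_fun (\<lambda>p k. 1 - 1 / real p) d = real d * mult_fun local_factor d"
proof -
  have "unitary_totient d * mult_fun (\<lambda>p k. 1 - 1 / real p) d =
      mult_fun (\<lambda>p k. (real p ^ k - 1) * (1 - 1 / real p)) d"
    by (simp add: unitary_totient_def mult_fun_mult)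
  also have "\<dots> = mult_fun (\<lambda>p k. real p ^ k * local_factor p k) d"
    by (rule mult_fun_cong) (auto simp: local_factor_def field_simps prime_gt_0_nat)
  also have "\<dots> = real d * mult_fun local_factor d"
    using assms mult_fun_id[of d] by (simp add: mult_fun_mult[symmetric])
  finally show ?thesis .
qed

lemma mult_fun_one_minus_inverse_bounds:
  "0 \<le> mult_fun (\<lambda>p k. 1 - 1 / real p) d" "mult_fun (\<lambda>p k. 1 - 1 / real p) d \<le> 1"
proof -
  have "0 \<le> 1 - 1 / real p \<and> 1 - 1 / real p \<le> 1" if "p \<in> prime_factors d" for p
    using prime_factor_ge_1[OF that] by simp
  thus "0 \<le> mult_fun (\<lambda>p k. 1 - 1 / real p) d" "mult_fun (\<lambda>p k. 1 - 1 / real p) d \<le> 1"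
    unfolding mult_fun_def by (blast intro: prod_nonneg prod_le_1)+
qed

text \<open>Replacing $\lfloor x/d \rfloor$ by $x/d$ costs at most $\varphi^*(d) \cdot x/d \le x$ for each $d \le x$,
and replacing the count of coprime integers by its main term costs at most $x$ times the error of the
count, whose sum over $d$ is $O(x)$.\<close>
lemma sum_semi_unitary_gcd_approx:
  fixes x :: real
  assumes x: "x \<ge> 1"
  defines "N \<equiv> nat \<lfloor>x\<rfloor>"
  shows "\<bar>(\<Sum>(i, j)\<in>{1..N} \<times> {1..N}. real (semi_unitary_gcd i j))
            - x\<^sup>2 * (\<Sum>d\<in>{1..N}. mult_fun local_factor d / real d)\<bar>
           \<le> (2 * zeta_three_halves + 1) * x\<^sup>2"
proof -
  let ?c = "\<lambda>d. mult_fun (\<lambda>p k. 1 - 1 / real p) d"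
  let ?E = "\<lambda>d. real (coprime_count (x / real d) d) - x / real d * ?c d"
  let ?f = "\<lambda>d. real (nat \<lfloor>x / real d\<rfloor>)"
  have bound: "\<bar>unitary_totient d * ?f d * real (coprime_count (x / real d) d)
      - x\<^sup>2 * (mult_fun local_factor d / real d)\<bar> \<le> x * \<bar>?E d\<bar> + x" if "d \<in> {1..N}" for d
  proof -
    have d: "d > 0" using that by simp
    have f: "0 \<le> ?f d" "?f d \<le> x / real d" "\<bar>?f d - x / real d\<bar> \<le> 1"
      using d x by (auto, linarith)
    have "mult_fun local_factor d = unitary_totient d * ?c d / real d"
      using unitary_totient_mult[OF d] d by simp
    hence eq: "unitary_totient d * ?f d * real (coprime_count (x / real d) d) - x\<^sup>2 * (mult_fun local_factor d / real d)
        = unitary_totient d * ?f d * ?E d + unitary_totient d * (?f d - x / real d) * (x / real d) * ?c d"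
      using d by (simp add: field_simps power2_eq_square)
    have "\<bar>unitary_totient d * ?f d * ?E d + unitary_totient d * (?f d - x / real d) * (x / real d) * ?c d\<bar> \<le> unitary_totient d * ?f d * \<bar>?E d\<bar> + unitary_totient d * \<bar>?f d - x / real d\<bar> * (x / real d) * ?c d"
      using x mult_fun_one_minus_inverse_bounds[of d] unitary_totient_nonneg[of d]
      by (intro order_trans[OF abs_triangle_ineq]) (simp add: abs_mult)
    also have "\<dots> \<le> x * \<bar>?E d\<bar> + x"
    proof (rule add_mono)
      have "unitary_totient d * ?f d \<le> real d * (x / real d)"
        using f unitary_totient_le[OF d] by - (rule mult_mono; auto)
      thus "unitary_totient d * ?f d * \<bar>?E d\<bar> \<le> x * \<bar>?E d\<bar>"
        using d by (intro mult_right_mono) auto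
      have "unitary_totient d * \<bar>?f d - x / real d\<bar> \<le> real d * 1"
        using f unitary_totient_le[OF d] by - (rule mult_mono; auto)
      moreover have "x / real d * ?c d \<le> x / real d * 1"
        using x mult_fun_one_minus_inverse_bounds[of d] by - (rule mult_left_mono; auto)
      ultimately have "(unitary_totient d * \<bar>?f d - x / real d\<bar>) * (x / real d * ?c d) \<le> (real d * 1) * (x / real d * 1)"
        using x mult_fun_one_minus_inverse_bounds[of d] by - (rule mult_mono; auto)
      thus "unitary_totient d * \<bar>?f d - x / real d\<bar> * (x / real d) * ?c d \<le> x"
        using d by simp
    qed
    finally show ?thesis unfolding eq .
  qed
  have "\<bar>(\<Sum>(i, j)\<in>{1..N} \<times> {1..N}. real (semi_unitary_gcd i j))
            - x\<^sup>2 * (\<Sum>d\<in>{1..N}. mult_fun local_factor d / real d)\<bar> =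
        \<bar>\<Sum>d\<in>{1..N}. unitary_totient d * ?f d * real (coprime_count (x / real d) d)
      - x\<^sup>2 * (mult_fun local_factor d / real d)\<bar>"
    unfolding N_def sum_semi_unitary_gcd by (simp add: sum_subtractf sum_distrib_left)
  also have "\<dots> \<le> (\<Sum>d\<in>{1..N}. x * \<bar>?E d\<bar> + x)"
    by (rule order_trans[OF sum_abs sum_mono[OF bound]])
  also have "\<dots> = x * (\<Sum>d\<in>{1..N}. \<bar>?E d\<bar>) + real N * x"
    by (simp add: sum.distrib sum_distrib_left)
  also have "\<dots> \<le> x * (2 * zeta_three_halves * x) + x * x"
    unfolding N_def using x sum_coprime_count_error[OF x]
    by (intro add_mono mult_left_mono mult_right_mono) auto
  also have "\<dots> = (2 * zeta_three_halves + 1) * x\<^sup>2" by (simp add: algebra_simps power2_eq_square)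
  finally show ?thesis .
qed

section \<open>The constant as an Euler product\<close>

text \<open>The partial Euler products of $\sum n^{-2}$, kept as finite products so that they combine
factor by factor with those of the infinite product in \<open>G_const\<close>.\<close>
lemma tendsto_euler_product_zeta_2:
  "(\<lambda>N. \<Prod>p<N. if prime p then 1 / (1 - 1 / (real p)\<^sup>2) else 1) \<longlonglongrightarrow> zeta 2"
proof -
  let ?F = "\<lambda>p k. 1 / (real p ^ k)\<^sup>2"
  have F: "?F p (Suc a) = 1 / (real p)\<^sup>2 * (1 / (real p)\<^sup>2) ^ a" for p a
    by (simp add: power_divide power_mult[symmetric] power_mult_distrib mult.commute)
  have p2: "1 / (real p)\<^sup>2 \<le> 1 / 2" if "prime p" for p
  proof -
    have "p \<ge> 2" using that by (rule prime_ge_2_nat)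
    hence "2 * 1 \<le> real p * real p" by (intro mult_mono) auto
    thus ?thesis using \<open>p \<ge> 2\<close> by (simp add: divide_simps power2_eq_square)
  qed
  have le: "\<bar>?F p (Suc a)\<bar> \<le> 1 / (real p)\<^sup>2 * (1/2) ^ a" if "prime p" for p a
  proof -
    have "1 / (real p)\<^sup>2 * (1 / (real p)\<^sup>2) ^ a \<le> 1 / (real p)\<^sup>2 * (1/2) ^ a"
      using p2[OF that] by (intro mult_left_mono power_mono) auto
    thus ?thesis by (subst abs_of_nonneg) (simp_all add: F del: power_Suc)
  qed
  have c: "summable (\<lambda>p. 1 / (real p)\<^sup>2)" "\<And>p::nat. 1 / (real p)\<^sup>2 \<ge> 0"
    using inverse_power_summable[of 2, where 'a = real] by (auto simp: field_simps)
  have mf: "mult_fun ?F n = 1 / (real n)\<^sup>2" if "n > 0" for n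
    using that by (induction n rule: prime_power_peel_induct)
                  (simp_all add: mult_fun_prime_power_mult power_mult_distrib)
  have "mult_fun ?F summable_on {0<..}"
    by (rule euler_product_geometric(1)[OF le c])
  hence "(mult_fun ?F has_sum (\<Sum>\<^sub>\<infinity>n\<in>{0<..}. mult_fun ?F n)) {0<..}" by (rule has_sum_infsum)
  moreover have "bij_betw Suc UNIV {0<..}"
    by (auto simp: bij_betw_def greaterThan_0)
  ultimately have "((\<lambda>n. mult_fun ?F (Suc n)) has_sum (\<Sum>\<^sub>\<infinity>n\<in>{0<..}. mult_fun ?F n)) UNIV"
    by (subst has_sum_reindex_bij_betw)
  from has_sum_imp_sums[OF this] have zeta: "(\<Sum>\<^sub>\<infinity>n\<in>{0<..}. mult_fun ?F n) = zeta 2"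
    unfolding zeta_def by (simp add: mf sums_iff powr_numeral del: of_nat_Suc)
  have "1 + (\<Sum>a. ?F p (Suc a)) = 1 / (1 - 1 / (real p)\<^sup>2)" if "prime p" for p
  proof -
    have "(\<lambda>a. (1 / (real p)\<^sup>2) ^ a) sums (1 / (1 - 1 / (real p)\<^sup>2))"
      by (rule geometric_sums) (use p2[OF that] in simp)
    from sums_mult[OF this, of "1 / (real p)\<^sup>2"]
    have "(\<Sum>a. ?F p (Suc a)) = 1 / (real p)\<^sup>2 * (1 / (1 - 1 / (real p)\<^sup>2))"
      unfolding F by (rule sums_unique[symmetric])
    moreover have "1 + x * (1 / (1 - x)) = 1 / (1 - x)" if "x \<le> 1/2" for x :: real
      using that by (simp add: divide_simps)
    ultimately show ?thesis using p2[OF that] by metis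
  qed
  hence "(\<Prod>p<N. if prime p then 1 + (\<Sum>a. ?F p (Suc a)) else 1) =
         (\<Prod>p<N. if prime p then 1 / (1 - 1 / (real p)\<^sup>2) else 1)" for N
    by (intro prod.cong refl if_cong) auto
  thus ?thesis using euler_product_geometric(2)[OF le c] zeta by simp
qed

lemma summable_inverse_squares: "summable (\<lambda>n. 1 / (real n + 1)\<^sup>2)"
proof -
  have "summable (\<lambda>n. inverse ((real (Suc n))\<^sup>2))"
    by (subst summable_Suc_iff, rule inverse_power_summable) simp
  thus ?thesis by (simp add: inverse_eq_divide add.commute)
qed

lemma zeta_2_nonzero: "zeta 2 \<noteq> 0"
proof -
  have "summable (\<lambda>n. 1 / real (Suc n) powr 2)"
    using summable_inverse_squares by (simp add: powr_numeral add.commute)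
  hence "zeta 2 > 0" unfolding zeta_def by (rule suminf_pos) simp
  thus ?thesis by simp
qed

text \<open>Merging the Euler product of $1/\zeta(2)$ with the infinite product in \<open>G_const\<close>.  The latter
converges because the factors are nonzero and differ from $1$ by a summable amount.\<close>
lemma tendsto_G_const:
  "(\<lambda>N. \<Prod>p<N. if prime p then (1 - 1 / (real p)\<^sup>2) * (1 - 1 / (real p + 1)\<^sup>2) else 1)
     \<longlonglongrightarrow> G_const"
proof -
  define z where "z = (\<lambda>q::nat. if prime q then - 1 / (real q + 1)\<^sup>2 else 0)"
  have z: "(if prime q then 1 - 1 / (real q + 1)\<^sup>2 else 1) = 1 + z q" for q
    by (simp add: z_def)
  have "summable (\<lambda>q. \<bar>z q\<bar>)"
  proof (rule summable_comparison_test')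
    show "summable (\<lambda>q. 1 / (real q + 1)\<^sup>2)"
      by (rule summable_inverse_squares)
  qed (auto simp: z_def)
  moreover have "z q \<noteq> -1" for q
  proof -
    have "1 < (real q + 1)\<^sup>2" if "prime q"
      using prime_gt_0_nat[OF that] by (intro one_less_power) auto
    thus ?thesis by (auto simp: z_def)
  qed
  ultimately have "convergent_prod (\<lambda>q. 1 + z q)" by (rule summable_imp_convergent_prod_real)
  hence "(\<lambda>N. \<Prod>q<N. 1 + z q) \<longlonglongrightarrow> (\<Prod>q. 1 + z q)"
    by (subst LIMSEQ_lessThan_iff_atMost) (rule convergent_prod_LIMSEQ)
  from tendsto_mult[OF tendsto_inverse[OF tendsto_euler_product_zeta_2 zeta_2_nonzero] this]
  show ?thesis
    unfolding G_const_def z prod_inversef[symmetric] prod.distrib[symmetric]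
    by (rule back_subst[of "\<lambda>f. f \<longlonglongrightarrow> _"]) (auto simp: fun_eq_iff z_def intro!: prod.cong)
qed

section \<open>Convolution structure of the mean value\<close>

text \<open>The values at prime powers of the Dirichlet quotient $g$ of $h$ by $1$: differences of consecutive
values of \<open>local_factor\<close>, whose value at exponent $0$ has to be read as $1$.\<close>
definition factor_increment :: "nat \<Rightarrow> nat \<Rightarrow> real" where
  "factor_increment p k = local_factor p k - (if k \<le> 1 then 1 else local_factor p (k - 1))"

lemma factor_increment_1: "factor_increment p (Suc 0) = (1 - 1 / real p)\<^sup>2 - 1"
  by (simp add: factor_increment_def local_factor_def power2_eq_square)

lemma factor_increment_Suc_Suc:
  assumes "p > 0"
  shows "factor_increment p (Suc (Suc a)) = (1 - 1 / real p)\<^sup>2 / real p ^ Suc a"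
  using assms by (simp add: factor_increment_def local_factor_def power2_eq_square field_simps)

lemma sum_divisors_factor_increment:
  assumes "n > 0"
  shows "(\<Sum>d | d dvd n. mult_fun factor_increment d) = mult_fun local_factor n"
proof -
  have "1 + (\<Sum>a=1..k. factor_increment p a) = local_factor p k" if "k > 0" for p k
    using that
  proof (induction k)
    case (Suc k)
    thus ?case by (cases "k = 0") (auto simp: factor_increment_def)
  qed simp
  thus ?thesis unfolding sum_divisors_mult_fun[OF assms] by (intro mult_fun_cong) auto
qed

text \<open>At $p$ the increment is about $-2/p$ and at $p^k$, $k \ge 2$, it is about $p^{-(k-1)}$.  Dividing by
$p^{k/2}$ therefore leaves $O(p^{-3/2})$ in all cases, with geometric decay in $k$.\<close>
lemma factor_increment_bound:
  assumes p: "prime p"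
  shows "\<bar>factor_increment p (Suc a)\<bar> / sqrt (real p) ^ Suc a \<le> 2 / (real p * sqrt (real p)) * (1/2) ^ a"
proof -
  have p2: "p \<ge> 2" using p by (rule prime_ge_2_nat)
  have s: "sqrt (real p) \<ge> 1" using p2 by simp
  show ?thesis
  proof (cases a)
    case 0
    have "1 - (1 - 1 / real p)\<^sup>2 = 2 / real p - 1 / (real p)\<^sup>2"
      using p2 by (simp add: power2_eq_square field_simps)
    moreover have "(1 - 1 / real p)\<^sup>2 \<le> 1" using p2 by (intro power_le_one) auto
    ultimately have "\<bar>factor_increment p (Suc 0)\<bar> \<le> 2 / real p"
      by (simp add: factor_increment_1)
    hence "\<bar>factor_increment p (Suc 0)\<bar> / sqrt (real p) \<le> 2 / real p / sqrt (real p)"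
      by (rule divide_right_mono) simp
    thus ?thesis using 0 by simp
  next
    case (Suc b)
    have "\<bar>factor_increment p (Suc a)\<bar> \<le> 1 / real p ^ Suc b"
      using p2 unfolding Suc
      by (subst factor_increment_Suc_Suc) (auto simp: abs_mult divide_right_mono power_le_one simp del: power_Suc)
    hence "\<bar>factor_increment p (Suc a)\<bar> / sqrt (real p) ^ Suc a \<le> 1 / real p ^ Suc b / sqrt (real p) ^ Suc a"
      by (rule divide_right_mono) simp
    also have "\<dots> = 1 / (real p * sqrt (real p)) * (1 / (real p ^ b * sqrt (real p) ^ a))"
      by simp
    also have "\<dots> \<le> 1 / (real p * sqrt (real p)) * (1 / (2 ^ b * 1))"
      using p2 s by (intro mult_left_mono divide_left_mono mult_mono power_mono one_le_power mult_pos_pos) auto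
    also have "\<dots> = 2 / (real p * sqrt (real p)) * (1/2) ^ a"
      by (simp add: Suc power_divide)
    finally show ?thesis .
  qed
qed

lemma summable_inverse_three_halves: "summable (\<lambda>p. 2 / (real p * sqrt (real p)))"
proof -
  have "2 * real p powr (-3/2) = 2 / (real p * sqrt (real p))" for p :: nat
    using powr_minus_three_halves[of p] by (cases "p = 0") simp_all
  thus ?thesis using summable_mult[OF summable_powr_three_halves, of 2] by simp
qed

lemma summable_factor_increment_sqrt:
  "(\<lambda>n. \<bar>mult_fun factor_increment n\<bar> / sqrt (real n)) summable_on {0<..}"
proof -
  let ?F = "\<lambda>p k. \<bar>factor_increment p k\<bar> / sqrt (real p) ^ k"
  have "mult_fun ?F summable_on {0<..}"
    by (rule euler_product_geometric(1)[OF _ summable_inverse_three_halves])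
       (use factor_increment_bound in auto)
  moreover have "mult_fun (\<lambda>p k. sqrt (real p) ^ k) n = sqrt (real n)" if "n > 0" for n
    using that by (induction n rule: prime_power_peel_induct)
                  (simp_all add: mult_fun_prime_power_mult real_sqrt_mult real_sqrt_power)
  hence "mult_fun ?F n = \<bar>mult_fun factor_increment n\<bar> / sqrt (real n)" if "n > 0" for n
    using that by (simp add: mult_fun_divide[symmetric] abs_mult_fun)
  ultimately show ?thesis by (subst (asm) summable_on_cong) auto
qed

text \<open>The Euler factor is $1 + ((1-1/p)^2 - 1)/p + (1-1/p)^2 p^{-3}/(1-p^{-2}) = (p-1)(p+2)/(p(p+1))$, which
is also $(1-p^{-2})(1-(p+1)^{-2})$.\<close>
lemma has_sum_factor_increment:
  "((\<lambda>n. mult_fun factor_increment n / real n) has_sum G_const) {0<..}"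
proof -
  let ?F = "\<lambda>p k. factor_increment p k / real p ^ k"
  have le: "\<bar>?F p (Suc a)\<bar> \<le> 2 / (real p * sqrt (real p)) * (1/2) ^ a" if p: "prime p" for p a
  proof -
    have p2: "p \<ge> 2" using p by (rule prime_ge_2_nat)
    have "sqrt (real p) \<le> real p" using p2 by (intro real_le_lsqrt) (auto simp: power2_eq_square)
    hence "\<bar>?F p (Suc a)\<bar> \<le> \<bar>factor_increment p (Suc a)\<bar> / sqrt (real p) ^ Suc a"
      using p2 by (auto simp: abs_mult simp del: power_Suc intro!: divide_left_mono power_mono)
    also note factor_increment_bound[OF p]
    finally show ?thesis .
  qed
  have c: "2 / (real p * sqrt (real p)) \<ge> 0" for p by simp
  have mf: "mult_fun ?F n = mult_fun factor_increment n / real n" if "n > 0" for n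
    using that by (simp add: mult_fun_divide[symmetric] mult_fun_id)
  have factor: "1 + (\<Sum>a. ?F p (Suc a)) = (1 - 1 / (real p)\<^sup>2) * (1 - 1 / (real p + 1)\<^sup>2)" if p: "prime p" for p
  proof -
    define x where "x = real p"
    have x: "x \<ge> 2" using prime_ge_2_nat[OF p] by (simp add: x_def)
    hence x1: "1 < x\<^sup>2" by (simp add: one_less_power)
    have eq: "?F p (Suc (Suc a)) = (1 - 1 / x)\<^sup>2 / x ^ 3 * (1 / x\<^sup>2) ^ a" for a
    proof -
      have "?F p (Suc (Suc a)) = (1 - 1 / x)\<^sup>2 / (x ^ Suc a * x ^ Suc (Suc a))"
        using x by (subst factor_increment_Suc_Suc) (auto simp: x_def)
      also have "x ^ Suc a * x ^ Suc (Suc a) = x ^ 3 * (x\<^sup>2) ^ a"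
        by (simp add: power_add[symmetric] power_mult[symmetric] mult_2 numeral_3_eq_3 flip: power_Suc)
      finally show ?thesis by (simp add: power_divide)
    qed
    have "(\<lambda>a. (1 / x\<^sup>2) ^ a) sums (1 / (1 - 1 / x\<^sup>2))"
      using x1 by (intro geometric_sums) (simp add: divide_less_eq)
    from sums_mult[OF this, of "(1 - 1 / x)\<^sup>2 / x ^ 3"]
    have "(\<lambda>a. ?F p (Suc (Suc a))) sums ((1 - 1 / x)\<^sup>2 / x ^ 3 * (1 / (1 - 1 / x\<^sup>2)))"
      unfolding eq .
    hence "(\<lambda>a. ?F p (Suc a)) sums ((1 - 1 / x)\<^sup>2 / x ^ 3 * (1 / (1 - 1 / x\<^sup>2)) + ?F p (Suc 0))"
      by (rule sums_Suc)
    hence "1 + (\<Sum>a. ?F p (Suc a)) = 1 + ((1 - 1 / x)\<^sup>2 / x ^ 3 * (1 / (1 - 1 / x\<^sup>2)) + ((1 - 1 / x)\<^sup>2 - 1) / x)"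
      by (simp add: sums_iff factor_increment_1 x_def)
    also have "\<dots> = (1 - 1 / x\<^sup>2) * (1 - 1 / (x + 1)\<^sup>2)"
    proof -
      have "1 - 1 / x\<^sup>2 = (x - 1) * (x + 1) / x\<^sup>2"
        using x by (simp add: field_simps power2_eq_square)
      moreover have "1 - 1 / x = (x - 1) / x" using x by (simp add: field_simps)
      moreover have "(a / x)\<^sup>2 / x ^ 3 * (1 / (a * b / x\<^sup>2)) = a / (x ^ 3 * b)" if "a \<noteq> 0" "b \<noteq> 0" for a b
        using x that by (simp add: field_simps power2_eq_square)
      ultimately have "(1 - 1 / x)\<^sup>2 / x ^ 3 * (1 / (1 - 1 / x\<^sup>2)) = (x - 1) / (x ^ 3 * (x + 1))"
        using x by simp
      moreover have "1 + ((x - 1) / (x ^ 3 * (x + 1)) + ((1 - 1 / x)\<^sup>2 - 1) / x) = (x - 1) * (x + 2) / (x * (x + 1))"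
        using x by (simp add: divide_simps) (simp add: algebra_simps eval_nat_numeral)
      moreover have "(1 - 1 / x\<^sup>2) * (1 - 1 / (x + 1)\<^sup>2) = (x - 1) * (x + 2) / (x * (x + 1))"
        using x by (simp add: divide_simps) (simp add: algebra_simps eval_nat_numeral)
      ultimately show ?thesis by simp
    qed
    finally show ?thesis by (simp add: x_def)
  qed
  have "(\<Prod>p<N. if prime p then 1 + (\<Sum>a. ?F p (Suc a)) else 1) =
      (\<Prod>p<N. if prime p then (1 - 1 / (real p)\<^sup>2) * (1 - 1 / (real p + 1)\<^sup>2) else 1)" for N
    by (intro prod.cong refl if_cong) (use factor in auto)
  hence "(\<Sum>\<^sub>\<infinity>n\<in>{0<..}. mult_fun ?F n) = G_const"
    using euler_product_geometric(2)[OF le summable_inverse_three_halves c] tendsto_G_const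
    by (auto intro: LIMSEQ_unique)
  moreover have "(mult_fun ?F has_sum (\<Sum>\<^sub>\<infinity>n\<in>{0<..}. mult_fun ?F n)) {0<..}"
    by (rule has_sum_infsum[OF euler_product_geometric(1)[OF le summable_inverse_three_halves c]])
  ultimately show ?thesis using mf by (subst (asm) has_sum_cong) auto
qed

section \<open>The asymptotic formula\<close>

lemma harmonic_sum_ln:
  assumes "y \<ge> 1"
  shows "\<bar>(\<Sum>k\<in>{1..nat \<lfloor>y\<rfloor>}. 1 / real k) - ln y\<bar> \<le> 1"
proof -
  define n where "n = nat \<lfloor>y\<rfloor>"
  have n: "n \<ge> 1" "real n \<le> y" "y < real n + 1"
    using assms by (auto simp: n_def le_nat_iff)
  have h: "(\<Sum>k\<in>{1..n}. 1 / real k) = harm n" by (simp add: harm_def inverse_eq_divide)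
  have "ln y \<le> ln (real n + 1)" using n assms by simp
  also have "\<dots> \<le> harm n" by (rule ln_le_harm)
  finally have "ln y \<le> harm n" .
  moreover have "harm n - ln (real n) \<le> 1"
    using euler_mascheroni_sequence_decreasing[of 1 n] n by (simp add: harm_def)
  moreover have "ln (real n) \<le> ln y" using n by simp
  ultimately show ?thesis unfolding n_def[symmetric] h by linarith
qed

text \<open>The sum is $\sum_m g(m)/m \cdot H(m)$, where $H(m)$ is the harmonic sum up to $x/m$ if $m \le x$ and $0$
otherwise.  In both cases $|H(m) - \log x| \le 1 + \log m \le 2 \sqrt m$: for $m > x$ because then
$0 \le \log x \le \log m$.  So replacing $H(m)$ by $\log x$ in the infinite series treats the
error terms and the tail together.\<close>
lemma sum_local_factor_ln:
  "\<exists>K. \<forall>x\<ge>1. \<bar>(\<Sum>n\<in>{1..nat \<lfloor>x\<rfloor>}. mult_fun local_factor n / real n) - G_const * ln x\<bar> \<le> K"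
proof (intro exI allI impI)
  let ?g = "mult_fun factor_increment"
  fix x :: real assume x: "x \<ge> 1"
  let ?N = "nat \<lfloor>x\<rfloor>"
  define H where "H = (\<lambda>d. if d \<in> {1..?N} then \<Sum>k\<in>{1..nat \<lfloor>x / real d\<rfloor>}. 1 / real k else 0)"
  have "(\<Sum>n\<in>{1..?N}. mult_fun local_factor n / real n) = (\<Sum>n\<in>{1..?N}. \<Sum>d | d dvd n. ?g d / real n)"
    by (intro sum.cong refl) (simp add: sum_divisors_factor_increment flip: sum_divide_distrib)
  also have "\<dots> = (\<Sum>d\<in>{1..?N}. \<Sum>k\<in>{1..nat \<lfloor>x / real d\<rfloor>}. ?g d / real (d * k))"
    by (rule sum_divisors_swap)
  also have "\<dots> = (\<Sum>d\<in>{1..?N}. ?g d / real d * H d)"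
    by (intro sum.cong refl) (simp add: H_def sum_distrib_left)
  finally have "((\<lambda>d. ?g d / real d * H d) has_sum (\<Sum>n\<in>{1..?N}. mult_fun local_factor n / real n)) {0<..}"
    by (intro has_sum_finite_neutralI[where B = "{1..?N}"]) (auto simp: H_def)
  from has_sum_add[OF this has_sum_cmult_left[OF has_sum_factor_increment, of "- ln x"]]
  have sum: "((\<lambda>d. ?g d / real d * H d - ?g d / real d * ln x) has_sum
      ((\<Sum>n\<in>{1..?N}. mult_fun local_factor n / real n) - G_const * ln x)) {0<..}" by simp
  have H: "\<bar>H d - ln x\<bar> \<le> 2 * sqrt (real d)" if d: "d > 0" for d
  proof -
    have "ln (real d) = 2 * ln (sqrt (real d))" using d by (simp add: ln_sqrt)
    also have "\<dots> \<le> 2 * (sqrt (real d) - 1)" using d by (intro mult_left_mono ln_le_minus_one) auto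
    finally have ln: "ln (real d) + 1 \<le> 2 * sqrt (real d)" by simp
    show ?thesis
    proof (cases "d \<in> {1..?N}")
      case True
      hence dx: "real d \<le> x" using d x by (simp add: le_nat_iff le_floor_iff)
      have "\<bar>H d - ln (x / real d)\<bar> \<le> 1"
        unfolding H_def if_P[OF True] by (rule harmonic_sum_ln) (use d dx in simp)
      moreover have "ln (x / real d) = ln x - ln (real d)" using d x by (simp add: ln_div)
      moreover have "ln (real d) \<ge> 0" using d by simp
      ultimately show ?thesis using ln by linarith
    next
      case False
      hence "x < real d" using d x by (auto simp: le_nat_iff le_floor_iff not_le)
      hence "ln x \<le> ln (real d)" "ln x \<ge> 0" using x by auto
      moreover have "H d = 0" using False by (simp only: H_def if_False)
      ultimately show ?thesis using ln by simp
    qed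
  qed
  have "norm ((\<Sum>n\<in>{1..?N}. mult_fun local_factor n / real n) - G_const * ln x)
      \<le> 2 * (\<Sum>\<^sub>\<infinity>n\<in>{0<..}. \<bar>?g n\<bar> / sqrt (real n))"
  proof (rule norm_infsum_le[OF sum has_sum_cmult_right[OF has_sum_infsum[OF summable_factor_increment_sqrt]]])
    fix d :: nat assume "d \<in> {0<..}"
    hence d: "d > 0" by simp
    have "norm (?g d / real d * H d - ?g d / real d * ln x) = \<bar>?g d\<bar> / real d * \<bar>H d - ln x\<bar>"
      by (simp only: right_diff_distrib[symmetric] real_norm_def abs_mult abs_divide abs_of_nat)
    also have "\<dots> \<le> \<bar>?g d\<bar> / real d * (2 * sqrt (real d))"
      using H[OF d] by (intro mult_left_mono) auto
    also have "\<dots> = 2 * (\<bar>?g d\<bar> / sqrt (real d))"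
      using d by (simp add: field_simps)
    finally show "norm (?g d / real d * H d - ?g d / real d * ln x) \<le> 2 * (\<bar>?g d\<bar> / sqrt (real d))" .
  qed
  thus "\<bar>(\<Sum>n\<in>{1..?N}. mult_fun local_factor n / real n) - G_const * ln x\<bar>
      \<le> 2 * (\<Sum>\<^sub>\<infinity>n\<in>{0<..}. \<bar>?g n\<bar> / sqrt (real n))" by simp
qed

theorem theorem6p2:
  "(\<lambda>x::real. (\<Sum>(i, j) \<in> {1..nat \<lfloor>x\<rfloor>} \<times> {1..nat \<lfloor>x\<rfloor>}. real (semi_unitary_gcd i j))
      - G_const * x\<^sup>2 * ln x) \<in> O[at_top](\<lambda>x. x\<^sup>2)"
proof -
  obtain K where K: "\<And>x. x \<ge> 1 \<Longrightarrow>
    \<bar>(\<Sum>n\<in>{1..nat \<lfloor>x\<rfloor>}. mult_fun local_factor n / real n) - G_const * ln x\<bar> \<le> K"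
    using sum_local_factor_ln by blast
  show ?thesis
  proof (rule bigoI[where c = "2 * zeta_three_halves + 1 + K"], rule eventually_mono[OF eventually_ge_at_top[of 1]])
    fix x :: real assume x: "x \<ge> 1"
    define S where "S = (\<Sum>(i, j) \<in> {1..nat \<lfloor>x\<rfloor>} \<times> {1..nat \<lfloor>x\<rfloor>}. real (semi_unitary_gcd i j))"
    define M where "M = (\<Sum>n\<in>{1..nat \<lfloor>x\<rfloor>}. mult_fun local_factor n / real n)"
    have "\<bar>S - x\<^sup>2 * M\<bar> \<le> (2 * zeta_three_halves + 1) * x\<^sup>2"
      unfolding S_def M_def by (rule sum_semi_unitary_gcd_approx[OF x])
    moreover have "\<bar>x\<^sup>2 * M - G_const * x\<^sup>2 * ln x\<bar> = \<bar>M - G_const * ln x\<bar> * x\<^sup>2"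
    proof -
      have "x\<^sup>2 * M - G_const * x\<^sup>2 * ln x = (M - G_const * ln x) * x\<^sup>2" by (simp add: algebra_simps)
      thus ?thesis by (simp only: abs_mult abs_power2)
    qed
    moreover have "\<bar>M - G_const * ln x\<bar> * x\<^sup>2 \<le> K * x\<^sup>2"
      using K[OF x] unfolding M_def by (intro mult_right_mono) auto
    ultimately have "\<bar>S - G_const * x\<^sup>2 * ln x\<bar> \<le> (2 * zeta_three_halves + 1) * x\<^sup>2 + K * x\<^sup>2"
      by linarith
    thus "norm (S - G_const * x\<^sup>2 * ln x) \<le> (2 * zeta_three_halves + 1 + K) * norm (x\<^sup>2)"
      by (simp add: algebra_simps)
  qed
qed

end
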